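(* Let $k,a_1,b_2$ be rational numbers and put $$A_1=7k^2b_2^2-4a_1^2,\quad A_2=-9k^2b_2^2-32kb_2a_1-68a_1^2,\quad A_3=3k^2b_2^2+20kb_2a_1+44a_1^2,$$ $$A_4=15k^2b_2^2+20kb_2a_1-28a_1^2,\quad A_5=11k^2b_2^2-20kb_2a_1-52a_1^2,\quad A_6=k^2b_2^2-44kb_2a_1-36a_1^2,$$ $$B_1=-k^2b_2^2-16kb_2a_1-36a_1^2,\quad B_2=15k^2b_2^2+16kb_2a_1+28a_1^2,\quad B_3=-9k^2b_2^2-4kb_2a_1-4a_1^2,$$ $$B_4=11k^2b_2^2+12kb_2a_1-44a_1^2,\quad B_5=7k^2b_2^2-28kb_2a_1-68a_1^2,\quad B_6=-3k^2b_2^2-52kb_2a_1-52a_1^2 .$$ Then $$A_1^6+A_2^6+A_3^6+A_4^6+A_5^6+A_6^6=B_1^6+B_2^6+B_3^6+B_4^6+B_5^6+B_6^6 .$$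
   Context: Here $k$, $a_1$, $b_2$ are free parameters. *)

theory Defs
  imports Complex_Main
begin

end

theory Submission
  imports Defs
begin

text \<open>
  Everything is a quadratic form in \<open>x = k * b2\<close> and \<open>y = a1\<close>, and \<open>A\<^sub>i - B\<^sub>i\<close> is a constant
  multiple of the single form \<open>u = x\<^sup>2 + 2 * x * y + 4 * y\<^sup>2\<close> for every \<open>i\<close>.  Moreover the
  midpoints \<open>(A\<^sub>i + B\<^sub>i) / 2\<close> are, in order, \<open>m\<close>, \<open>m\<close>, \<open>- m\<close>, \<open>2 * m + r\<close>, \<open>3 * m\<close>, \<open>2 * m - r\<close>,
  where \<open>m = 3 * x\<^sup>2 - 8 * x * y - 20 * y\<^sup>2\<close> and \<open>r = 7 * x\<^sup>2 + 32 * x * y + 4 * y\<^sup>2\<close>.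
  For independent \<open>u\<close>, \<open>m\<close>, \<open>r\<close> the difference of the two sums of sixth powers has
  \<open>r\<^sup>2 + 3 * m\<^sup>2 - 76 * u\<^sup>2\<close> as a factor (\<open>sixth_powers_factorization\<close>), so the sums agree at
  every point of the conic \<open>r\<^sup>2 + 3 * m\<^sup>2 = 76 * u\<^sup>2\<close>.  The three quadratic forms above are a
  rational parametrization of exactly this conic (\<open>conic_parametrization\<close>).
\<close>

text \<open>
  Each difference \<open>(M + e * u)^6 - (M - e * u)^6\<close> is odd in \<open>u\<close> and odd in the midpoint \<open>M\<close>.
  The values of \<open>e\<close> are \<open>4\<close>, \<open>-12\<close>, \<open>6\<close>, \<open>2\<close>, \<open>2\<close>, \<open>2\<close>, and the odd powers of \<open>r\<close> cancel between
  the midpoints \<open>2 * m + r\<close> and \<open>2 * m - r\<close>.  Hence \<open>u * m\<close> splits off, leaving a quadratic polynomial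
  in \<open>r\<^sup>2\<close> whose coefficients are forms in \<open>m\<^sup>2\<close> and \<open>u\<^sup>2\<close>; the choice of the \<open>e\<close> makes it reducible.
\<close>
lemma sixth_powers_factorization:
  fixes m r u :: "'a :: idom"
  shows "((m + 4 * u)^6 + (m - 12 * u)^6 + (- m + 6 * u)^6
           + (2 * m + r + 2 * u)^6 + (3 * m + 2 * u)^6 + (2 * m - r + 2 * u)^6)
       - ((m - 4 * u)^6 + (m + 12 * u)^6 + (- m - 6 * u)^6
           + (2 * m + r - 2 * u)^6 + (3 * m - 2 * u)^6 + (2 * m - r - 2 * u)^6)
       = 480 * u * m * (r^2 + 3 * m^2 - 76 * u^2) * (r^2 + 5 * m^2 + 84 * u^2)"
  by algebra

lemma conic_parametrization:
  fixes x y :: "'a :: idom"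
  shows "(7 * x^2 + 32 * x * y + 4 * y^2)^2 + 3 * (3 * x^2 - 8 * x * y - 20 * y^2)^2
       = 76 * (x^2 + 2 * x * y + 4 * y^2)^2"
  by algebra

theorem mainTheorem5:
  fixes k a1 b2 :: rat
    and A1 A2 A3 A4 A5 A6 B1 B2 B3 B4 B5 B6 :: rat
  assumes "A1 = 7 * k^2 * b2^2 - 4 * a1^2"
    and "A2 = - (9 * k^2 * b2^2) - 32 * k * b2 * a1 - 68 * a1^2"
    and "A3 = 3 * k^2 * b2^2 + 20 * k * b2 * a1 + 44 * a1^2"
    and "A4 = 15 * k^2 * b2^2 + 20 * k * b2 * a1 - 28 * a1^2"
    and "A5 = 11 * k^2 * b2^2 - 20 * k * b2 * a1 - 52 * a1^2"
    and "A6 = k^2 * b2^2 - 44 * k * b2 * a1 - 36 * a1^2"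
    and "B1 = - (k^2 * b2^2) - 16 * k * b2 * a1 - 36 * a1^2"
    and "B2 = 15 * k^2 * b2^2 + 16 * k * b2 * a1 + 28 * a1^2"
    and "B3 = - (9 * k^2 * b2^2) - 4 * k * b2 * a1 - 4 * a1^2"
    and "B4 = 11 * k^2 * b2^2 + 12 * k * b2 * a1 - 44 * a1^2"
    and "B5 = 7 * k^2 * b2^2 - 28 * k * b2 * a1 - 68 * a1^2"
    and "B6 = - (3 * k^2 * b2^2) - 52 * k * b2 * a1 - 52 * a1^2"
  shows "A1^6 + A2^6 + A3^6 + A4^6 + A5^6 + A6^6 = B1^6 + B2^6 + B3^6 + B4^6 + B5^6 + B6^6"
proof -
  define x y where "x = k * b2" and "y = a1"
  define u where "u = x^2 + 2 * x * y + 4 * y^2"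
  define m where "m = 3 * x^2 - 8 * x * y - 20 * y^2"
  define r where "r = 7 * x^2 + 32 * x * y + 4 * y^2"
  have A: "A1 = m + 4 * u"
    "A2 = m - 12 * u"
    "A3 = - m + 6 * u"
    "A4 = 2 * m + r + 2 * u"
    "A5 = 3 * m + 2 * u"
    "A6 = 2 * m - r + 2 * u"
    unfolding assms u_def m_def r_def x_def y_def by (simp_all add: power_mult_distrib)
  have B: "B1 = m - 4 * u"
    "B2 = m + 12 * u"
    "B3 = - m - 6 * u"
    "B4 = 2 * m + r - 2 * u"
    "B5 = 3 * m - 2 * u"
    "B6 = 2 * m - r - 2 * u"
    unfolding assms u_def m_def r_def x_def y_def by (simp_all add: power_mult_distrib)
  have "r^2 + 3 * m^2 - 76 * u^2 = 0"
    unfolding u_def m_def r_def by (simp add: conic_parametrization)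
  then show ?thesis
    using sixth_powers_factorization[of m u r] by (simp add: A B)
qed

end
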